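(* Let $E$ be a Banach space, $\Lambda\subset E$ open, $x_0\in\Lambda$, and $\mathcal F=\{M(x):x\in\Lambda\}$ a family of linear subspaces of $E$ (of possibly infinite dimension). If $\mathcal F$ is $c^1$ integrable at $x_0$ and $S$ is its integral submanifold in $E$ at $x_0$, then (i) $M(x_0)$ is splitting in $E$; (ii) for an arbitrary complement $E_*$ of $M(x_0)$ there exist a neighborhood $U_0$ of $x_0$ and a $c^1$ diffeomorphism $\varphi$ from $U_0$ onto $\varphi(U_0)$ such that $\varphi'(x_0)=I_E$, the set $\varphi(S\cap U_0)$ is an open set in $M(x_0)$, $$\varphi'(x)M(x)=M(x_0)\quad\text{for all }x\in S\cap U_0,$$ and $$J(x_0,E_* )\supset U_0\cap S.$$
   Context: A direct sum $M\oplus N=E$ means that $M,N$ are closed subspaces with $M\cap N=\{0\}$ and $M+N=E$; $N$ is then called a complement of $M$, and $M$ is said to be splitting (split) in $E$ if it has such a complement. Co-tailed set: if $E=M(x_0)\oplus E_*$, then $J(x_0,E_* )=\{x\in\Lambda: M(x)\oplus E_*=E\}$. A subset $S\subset E$ is a $c^1$ submanifold of $E$ if for each $x\in S$ there are a subspace $E_0$ splitting in $E$, a neighborhood $U$ of $x$ in $E$, and a $c^1$ diffeomorphism $\varphi$ of $U$ onto an open set $\varphi(U)\subset E$ such that $\varphi(S\cap U)$ is an open set in $E_0$. The tangent space is $T_xS=\{\dot c(0): c:(-\delta,\delta)\to S \text{ a } c^1 \text{ curve with } c(0)=x,\ \delta>0\}$. $\mathcal F$ is $c^1$ integrable at $x_0$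 if there is a $c^1$ submanifold $S$ of $E$ with $x_0\in S\subset\Lambda$ and $T_xS=M(x)$ for all $x\in S$; such an $S$ is called an integral submanifold of $\mathcal F$ at $x_0$. $I_E$ is the identity of $E$, and $\varphi'$ is the Fréchet derivative. *)

theory Defs
  imports "HOL-Analysis.Analysis"
begin

definition direct_sum_decomp :: "'a::real_normed_vector set \<Rightarrow> 'a set \<Rightarrow> bool" where
  "direct_sum_decomp M N \<longleftrightarrow>
     subspace M \<and> closed M \<and> subspace N \<and> closed N \<and>
     M \<inter> N = {0} \<and> {m + n | m n. m \<in> M \<and> n \<in> N} = UNIV"

definition splitting :: "'a::real_normed_vector set \<Rightarrow> bool" where
  "splitting M \<longleftrightarrow> (\<exists>N. direct_sum_decomp M N)"

text \<open>Continuity of the derivative is with respect to the operator norm.\<close>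

definition c1_on :: "'a::real_normed_vector set \<Rightarrow> ('a \<Rightarrow> 'b::real_normed_vector) \<Rightarrow> bool" where
  "c1_on U f \<longleftrightarrow>
     (\<exists>f' :: 'a \<Rightarrow> 'a \<Rightarrow>\<^sub>L 'b.
        (\<forall>x\<in>U. (f has_derivative blinfun_apply (f' x)) (at x)) \<and> continuous_on U f')"

text \<open>Functions are total, but only the values on \<open>U\<close> matter, since \<open>U\<close> and
  \<open>f ` U\<close> are required to be open.\<close>

definition c1_diffeo_on :: "'a::real_normed_vector set \<Rightarrow> ('a \<Rightarrow> 'b::real_normed_vector) \<Rightarrow> bool" where
  "c1_diffeo_on U f \<longleftrightarrow>
     open U \<and> open (f ` U) \<and> inj_on f U \<and> c1_on U f \<and> c1_on (f ` U) (inv_into U f)"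

definition c1_submanifold :: "'a::real_normed_vector set \<Rightarrow> bool" where
  "c1_submanifold S \<longleftrightarrow>
     (\<forall>x\<in>S. \<exists>E\<^sub>0 U \<phi>. splitting E\<^sub>0 \<and> x \<in> U \<and> c1_diffeo_on U (\<phi> :: 'a \<Rightarrow> 'a) \<and>
        openin (top_of_set E\<^sub>0) (\<phi> ` (S \<inter> U)))"

definition tangent_space :: "'a::real_normed_vector set \<Rightarrow> 'a \<Rightarrow> 'a set" where
  "tangent_space S x =
     {v. \<exists>\<delta>>0. \<exists>c. c ` {-\<delta><..<\<delta>} \<subseteq> S \<and> c C1_differentiable_on {-\<delta><..<\<delta>} \<and>
           c 0 = x \<and> (c has_vector_derivative v) (at 0)}"

definition integral_submanifold ::
    "'a::real_normed_vector set \<Rightarrow> ('a \<Rightarrow> 'a set) \<Rightarrow> 'a \<Rightarrow> 'a set \<Rightarrow> bool" where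
  "integral_submanifold \<Lambda> M x\<^sub>0 S \<longleftrightarrow>
     c1_submanifold S \<and> x\<^sub>0 \<in> S \<and> S \<subseteq> \<Lambda> \<and> (\<forall>x\<in>S. tangent_space S x = M x)"

definition c1_integrable_at ::
    "'a::real_normed_vector set \<Rightarrow> ('a \<Rightarrow> 'a set) \<Rightarrow> 'a \<Rightarrow> bool" where
  "c1_integrable_at \<Lambda> M x\<^sub>0 \<longleftrightarrow> (\<exists>S. integral_submanifold \<Lambda> M x\<^sub>0 S)"

text \<open>The co-tailed set \<open>J(x\<^sub>0, E\<^sub>*)\<close>. The base point enters only through the side condition
  \<open>direct_sum_decomp (M x\<^sub>0) E\<^sub>*\<close>, under which the set is considered, so it is not an argument.\<close>

definition co_tailed_set ::
    "'a::real_normed_vector set \<Rightarrow> ('a \<Rightarrow> 'a set) \<Rightarrow> 'a set \<Rightarrow> 'a set" where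
  "co_tailed_set \<Lambda> M N = {x \<in> \<Lambda>. direct_sum_decomp (M x) N}"

end

theory Submission imports Defs begin

text \<open>Let \<open>f\<close> be a chart of \<open>S\<close> around \<open>x\<^sub>0\<close>, sending \<open>S\<close> onto an open
  subset of the split subspace \<open>E\<close>. Curves in \<open>S\<close> correspond under \<open>f\<close> to curves in \<open>E\<close>, so the
  tangent space of \<open>S\<close> at each of its points \<open>x\<close> in the chart domain is the preimage of \<open>E\<close> under \<open>f'(x)\<close>
  (\<open>tangent_space_in_chart\<close>). Integrability therefore says that \<open>M(x) = f'(x)\<^bsup>-1\<^esup> E\<close> there. At \<open>x\<^sub>0\<close>
  this is the image of a split subspace under a linear homeomorphism, which gives the splitting of
  \<open>M(x\<^sub>0)\<close>. It also shows that the chart of the second part can be taken to be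
  \<open>\<phi>(x) = f'(x\<^sub>0)\<^bsup>-1\<^esup> (f(x) - f(x\<^sub>0))\<close>, the chart \<open>f\<close> normalised at \<open>x\<^sub>0\<close>: it flattens \<open>S\<close> into
  \<open>M(x\<^sub>0)\<close>, and its derivative maps \<open>M(x)\<close> onto \<open>f'(x\<^sub>0)\<^bsup>-1\<^esup> E = M(x\<^sub>0)\<close>. The complement enters
  only when the domain of \<open>\<phi>\<close> is shrunk.

  For a complement \<open>N\<close> of \<open>M(x\<^sub>0)\<close>, let \<open>P\<close> be the projection onto \<open>M(x\<^sub>0)\<close> along \<open>N\<close>. The operator
  \<open>T(x) = f'(x)\<^bsup>-1\<^esup> f'(x\<^sub>0) P + (I - P)\<close> maps \<open>M(x\<^sub>0)\<close> onto \<open>M(x)\<close>, fixes \<open>N\<close> pointwise, depends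
  continuously on \<open>x\<close> in operator norm, and is the identity at \<open>x\<^sub>0\<close>. Near \<open>x\<^sub>0\<close> it is within
  distance 1 of the identity, hence bijective (\<open>bij_blinfun_near_id\<close>), and it carries the
  decomposition \<open>M(x\<^sub>0) \<oplus> N\<close> to \<open>M(x) \<oplus> N\<close>. The norm of \<open>T(x) - I\<close> makes sense because \<open>P\<close> is
  bounded, which completeness of the space forces because both summands are closed
  (\<open>closed_graph_theorem\<close>, \<open>direct_sum_decomp_projection\<close>).\<close>

section \<open>The closed graph theorem\<close>

lemma complete_space_Baire:
  fixes A :: "nat \<Rightarrow> 'a::complete_space set"
  assumes "\<And>n. closed (A n)" and "(\<Union>n. A n) = UNIV"
  obtains n where "interior (A n) \<noteq> {}"
proof -
  have "completely_metrizable_space (euclidean :: 'a topology)"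
    unfolding completely_metrizable_space_def
    by (metis Met_TC.Metric_space_axioms Met_TC.mcomplete_def MCauchy_iff_Cauchy limitin_iff_tendsto
        mtopology_is_euclidean Cauchy_convergent convergent_def)
  then have "euclidean interior_of \<Union>(range A) = {}" if "\<forall>n. interior (A n) = {}"
    using that assms(1) by (intro Baire_category_alt) auto
  then show ?thesis
    using assms(2) that by fastforce
qed

text \<open>The classical Baire argument. Some set \<open>A k = {x. norm (f x) \<le> k}\<close> is dense in a ball; since
  \<open>A k\<close> is symmetric and midpoint-convex, it is dense in a ball around \<open>0\<close>. Scaling by powers of
  \<open>1/2\<close>, a vector \<open>x\<close> of that ball is the sum of a series of vectors \<open>y\<^sub>n\<close> with
  \<open>norm (f y\<^sub>n) \<le> k / 2\<^sup>n\<close>, and the closed graph identifies \<open>f x\<close> with \<open>\<Sum>n. f y\<^sub>n\<close>, whose norm is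
  at most \<open>2 * k\<close>.\<close>

theorem closed_graph_theorem:
  fixes f :: "'a::banach \<Rightarrow> 'b::banach"
  assumes lin: "linear f"
    and graph: "\<And>u a b. u \<longlonglongrightarrow> a \<Longrightarrow> (\<lambda>n. f (u n)) \<longlonglongrightarrow> b \<Longrightarrow> f a = b"
  shows "bounded_linear f"
proof -
  interpret f: linear f by (rule lin)
  define A where "A k = {x. norm (f x) \<le> real k}" for k
  have "(\<Union>k. closure (A k)) = UNIV"
  proof -
    have "x \<in> closure (A (nat \<lceil>norm (f x)\<rceil>))" for x
      by (rule subsetD[OF closure_subset]) (simp add: A_def real_nat_ceiling_ge)
    then show ?thesis by blast
  qed
  then obtain k where "interior (closure (A k)) \<noteq> {}"
    using complete_space_Baire[of "\<lambda>k. closure (A k)", OF closed_closure] by blast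
  then obtain a r where r: "r > 0" and ball: "ball a r \<subseteq> closure (A k)"
    by (metis ex_in_conv mem_interior)
  have near_unit: "\<exists>y. norm (f y) \<le> k \<and> norm (x - y) < e" if x: "norm x < r" and e: "e > 0" for x e
  proof -
    \<comment> \<open>\<open>x\<close> is half the difference of \<open>a + x\<close> and \<open>a - x\<close>, two points near elements of \<open>A k\<close>.\<close>
    have "a + x \<in> closure (A k)" "a - x \<in> closure (A k)"
      using ball x by (auto simp: subset_iff dist_norm)
    then obtain y z where yz: "y \<in> A k" "dist y (a + x) < e" "z \<in> A k" "dist z (a - x) < e"
      using e by (metis closure_approachable)
    have "norm (f y - f z) \<le> real k + real k"
      using yz norm_triangle_ineq4[of "f y" "f z"] by (simp add: A_def)
    then have "norm (f ((1/2) *\<^sub>R (y - z))) \<le> k"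
      by (simp add: f.scaleR f.diff)
    moreover have "x - (1/2) *\<^sub>R (y - z) = (1/2) *\<^sub>R ((a + x - y) - (a - x - z))"
      by (simp add: algebra_simps flip: scaleR_add_left)
    then have "norm (x - (1/2) *\<^sub>R (y - z)) \<le> (1/2) * (norm (a + x - y) + norm (a - x - z))"
      using norm_triangle_ineq4[of "a + x - y" "a - x - z"] by simp
    then have "norm (x - (1/2) *\<^sub>R (y - z)) < e"
      using yz by (simp add: dist_norm norm_minus_commute)
    ultimately show ?thesis by blast
  qed
  have near: "\<exists>y. norm (f y) \<le> k * c \<and> norm (x - y) < e"
    if x: "norm x < r * c" and e: "e > 0" and c: "c > 0" for x and e c :: real
  proof -
    have "norm (x /\<^sub>R c) < r" using x c by (simp add: field_simps)
    then obtain y where y: "norm (f y) \<le> k" "norm (x /\<^sub>R c - y) < e / c"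
      using near_unit[of "x /\<^sub>R c" "e / c"] e c by auto
    have "x - c *\<^sub>R y = c *\<^sub>R (x /\<^sub>R c - y)" using c by (simp add: scaleR_diff_right)
    then have "norm (x - c *\<^sub>R y) = c * norm (x /\<^sub>R c - y)" using c by (metis abs_of_pos norm_scaleR)
    then have "norm (x - c *\<^sub>R y) < e" using y c by (simp add: pos_less_divide_eq mult.commute)
    moreover have "norm (f (c *\<^sub>R y)) \<le> k * c"
      using y c by (simp add: f.scaleR mult.commute mult_left_mono)
    ultimately show ?thesis by blast
  qed
  have unit_bound: "norm (f x) \<le> 2 * k" if x: "norm x < r" for x
  proof -
    define Y where "Y n z = (SOME y. norm (f y) \<le> k * (1/2)^n \<and> norm (z - y) < r * (1/2)^Suc n)" for n z
    have Y: "norm (f (Y n z)) \<le> k * (1/2)^n" "norm (z - Y n z) < r * (1/2)^Suc n"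
      if "norm z < r * (1/2)^n" for n z
      using someI_ex[OF near[OF that, of "r * (1/2)^Suc n"]] r unfolding Y_def by auto
    \<comment> \<open>\<open>R n\<close> is what remains of \<open>x\<close> after \<open>n\<close> successive approximations; the bound on it halves at each step.\<close>
    define R where "R = rec_nat x (\<lambda>n z. z - Y n z)"
    have R_Suc: "R (Suc n) = R n - Y n (R n)" for n by (simp add: R_def)
    have R: "norm (R n) < r * (1/2)^n" for n
    proof (induction n)
      case 0 then show ?case using x by (simp add: R_def)
    next
      case (Suc n) then show ?case using Y(2)[OF Suc] by (simp add: R_Suc)
    qed
    have "(\<lambda>n. r * (1/2)^n) \<longlonglongrightarrow> r * 0"
      by (intro tendsto_intros LIMSEQ_power_zero) auto
    then have "R \<longlonglongrightarrow> 0"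
      by (intro Lim_null_comparison[of R "\<lambda>n. r * (1/2)^n"]) (auto intro!: always_eventually less_imp_le R)
    then have lim: "(\<lambda>n. x - R n) \<longlonglongrightarrow> x"
      using tendsto_diff[OF tendsto_const, of R 0 sequentially x] by simp
    have sum: "f (x - R n) = (\<Sum>i<n. f (Y i (R i)))" for n
      by (induction n) (simp_all add: R_Suc f.diff f.add f.zero algebra_simps, simp add: R_def)
    have geo: "(\<lambda>n. k * (1/2)^n) sums (k * 2 :: real)"
      using sums_mult[OF geometric_sums[of "1/2::real"], of k] by simp
    have sm: "summable (\<lambda>i. norm (f (Y i (R i))))"
      by (rule summable_comparison_test'[OF sums_summable[OF geo], of 0]) (simp add: Y(1) R)
    have "f x = (\<Sum>i. f (Y i (R i)))"
      using graph[OF lim] summable_LIMSEQ[OF summable_norm_cancel[OF sm]] by (simp add: sum)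
    also have "norm \<dots> \<le> (\<Sum>i. norm (f (Y i (R i))))" by (rule summable_norm[OF sm])
    also have "\<dots> \<le> (\<Sum>n. k * (1/2)^n)"
      by (rule suminf_le[OF _ sm sums_summable[OF geo]]) (simp add: Y(1) R)
    also have "\<dots> = 2 * k" using sums_unique[OF geo] by simp
    finally show ?thesis .
  qed
  show ?thesis
  proof (rule bounded_linear_intro[where K = "4 * k / r"])
    show "norm (f x) \<le> norm x * (4 * k / r)" for x
    proof (cases "x = 0")
      case False
      define c where "c = r / (2 * norm x)"
      have c: "c > 0" "norm (c *\<^sub>R x) < r" using r False by (auto simp: c_def)
      have "c * norm (f x) \<le> 2 * k"
        using unit_bound[OF c(2)] c by (simp add: f.scaleR)
      then show ?thesis using False r by (simp add: c_def field_simps)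
    qed (simp add: f.zero)
  qed (simp_all add: f.add f.scaleR)
qed

section \<open>Direct sums and their images\<close>

text \<open>Closedness of both summands gives the projection a closed graph: limits of \<open>P (u n)\<close> and of
  \<open>u n - P (u n)\<close> stay in \<open>M\<close> and \<open>N\<close>, and the decomposition of the limit is unique.\<close>

lemma direct_sum_decomp_projection:
  fixes M N :: "'a::banach set"
  assumes "direct_sum_decomp M N"
  obtains P where "bounded_linear P" "\<And>m. m \<in> M \<Longrightarrow> P m = m" "\<And>n. n \<in> N \<Longrightarrow> P n = 0"
proof -
  have M: "subspace M" "closed M" and N: "subspace N" "closed N" and MN: "M \<inter> N = {0}"
    and "{m + n | m n. m \<in> M \<and> n \<in> N} = UNIV"
    using assms unfolding direct_sum_decomp_def by simp_all
  then have "x \<in> {m + n | m n. m \<in> M \<and> n \<in> N}" for x by simp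
  then have sum: "\<exists>m\<in>M. x - m \<in> N" for x
  proof -
    have "x \<in> {m + n | m n. m \<in> M \<and> n \<in> N}" by fact
    then obtain m n where "x = m + n" "m \<in> M" "n \<in> N" by blast
    then show ?thesis by (intro bexI[of _ m]) simp_all
  qed
  have uniq: "m = m'" if "m \<in> M" "m' \<in> M" "x - m \<in> N" "x - m' \<in> N" for m m' x
  proof -
    have "(x - m') - (x - m) \<in> N" using that N subspace_diff by blast
    then have "m - m' \<in> N" by simp
    moreover have "m - m' \<in> M" using that M subspace_diff by blast
    ultimately have "m - m' = 0" using MN by blast
    then show ?thesis by simp
  qed
  obtain P where P: "\<And>x. P x \<in> M" "\<And>x. x - P x \<in> N" using sum by metis
  have PI: "P x = m" if "m \<in> M" "x - m \<in> N" for x m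
    using P that by (intro uniq[of _ _ x]) 
  have "linear P"
  proof (rule linearI)
    show "P (x + y) = P x + P y" for x y
      using P subspace_add[OF M(1)] subspace_add[OF N(1), of "x - P x" "y - P y"]
      by (intro PI) (simp_all add: algebra_simps)
    show "P (c *\<^sub>R x) = c *\<^sub>R P x" for c x
      using P subspace_scale[OF M(1)] subspace_scale[OF N(1), of "x - P x" c]
      by (intro PI) (auto simp: algebra_simps)
  qed
  moreover have "P a = b" if "u \<longlonglongrightarrow> a" "(\<lambda>n. P (u n)) \<longlonglongrightarrow> b" for u a b
  proof (rule PI)
    show "b \<in> M" using M(2) P(1) that(2) by (rule closed_sequentially)
    show "a - b \<in> N" using N(2) P(2) tendsto_diff[OF that] by (rule closed_sequentially)
  qed
  ultimately have "bounded_linear P" by (rule closed_graph_theorem)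
  moreover have "P m = m" if "m \<in> M" for m using that subspace_0[OF N(1)] by (intro PI) simp_all
  moreover have "P n = 0" if "n \<in> N" for n using that subspace_0[OF M(1)] by (intro PI) simp_all
  ultimately show ?thesis by (rule that)
qed

text \<open>Solving \<open>T x = y\<close> means finding the fixed point of \<open>x \<mapsto> y - (T - I) x\<close>, a contraction.\<close>

lemma bij_blinfun_near_id:
  fixes T :: "'a::banach \<Rightarrow>\<^sub>L 'a"
  assumes "norm (T - id_blinfun) < 1"
  shows "bij (blinfun_apply T)"
proof -
  let ?c = "norm (T - id_blinfun)"
  have "\<exists>!x. y - (T - id_blinfun) x = x" for y
  proof (rule banach_fix_type[of ?c])
    show "\<forall>x z. dist (y - (T - id_blinfun) x) (y - (T - id_blinfun) z) \<le> ?c * dist x z"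
    proof (intro allI)
      fix x z
      have "dist (y - (T - id_blinfun) x) (y - (T - id_blinfun) z) = norm ((T - id_blinfun) (z - x))"
        unfolding dist_norm by (simp add: blinfun.diff_right)
      also have "\<dots> \<le> ?c * dist x z"
        using norm_blinfun[of "T - id_blinfun" "z - x"] by (simp add: dist_norm norm_minus_commute)
      finally show "dist (y - (T - id_blinfun) x) (y - (T - id_blinfun) z) \<le> ?c * dist x z" .
    qed
  qed (use assms in auto)
  moreover have "(y - (T - id_blinfun) x = x) \<longleftrightarrow> T x = y" for x y
    by (auto simp: blinfun.diff_left algebra_simps)
  ultimately show ?thesis by (simp add: bij_iff)
qed

lemma direct_sum_decomp_image:
  assumes T: "linear T" "bij T" and MN: "direct_sum_decomp M N"
    and cl: "closed (T ` M)" "closed (T ` N)"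
  shows "direct_sum_decomp (T ` M) (T ` N)"
proof -
  have "T ` M \<inter> T ` N = T ` (M \<inter> N)" using T(2) by (simp add: bij_is_inj image_Int)
  moreover have "\<exists>m\<in>M. \<exists>n\<in>N. y = T m + T n" for y
  proof -
    obtain x where "y = T x" using T(2) by (metis bij_pointE)
    moreover obtain m n where "m \<in> M" "n \<in> N" "x = m + n"
      using MN unfolding direct_sum_decomp_def by blast
    ultimately show ?thesis using T(1) linear_add by blast
  qed
  then have "{m + n | m n. m \<in> T ` M \<and> n \<in> T ` N} = UNIV" by blast
  ultimately show ?thesis
    using MN T(1) cl unfolding direct_sum_decomp_def
    by (simp add: linear_subspace_image linear_0)
qed

section \<open>Calculus of \<open>c\<^sup>1\<close> diffeomorphisms\<close>

lemma c1_onE: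
  assumes "c1_on U f"
  obtains f' where "\<And>x. x \<in> U \<Longrightarrow> (f has_derivative blinfun_apply (f' x)) (at x)" "continuous_on U f'"
  using assms unfolding c1_on_def by blast

lemma c1_onI:
  assumes "\<And>x. x \<in> U \<Longrightarrow> (f has_derivative blinfun_apply (f' x)) (at x)" "continuous_on U f'"
  shows "c1_on U f"
  using assms unfolding c1_on_def by blast

lemma c1_on_imp_continuous_on: "c1_on U f \<Longrightarrow> continuous_on U f"
  by (erule c1_onE) (blast intro: continuous_at_imp_continuous_on has_derivative_continuous)

lemma c1_on_subset: "c1_on U f \<Longrightarrow> V \<subseteq> U \<Longrightarrow> c1_on V f"
  by (erule c1_onE, rule c1_onI) (auto intro: continuous_on_subset)

lemma c1_on_cong:
  assumes "c1_on U f" "open U" "\<And>x. x \<in> U \<Longrightarrow> f x = g x"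
  shows "c1_on U g"
proof -
  obtain f' where f': "\<And>x. x \<in> U \<Longrightarrow> (f has_derivative blinfun_apply (f' x)) (at x)"
    and cont: "continuous_on U f'" using assms(1) by (rule c1_onE) (rule that)
  have "(g has_derivative blinfun_apply (f' x)) (at x)" if "x \<in> U" for x
    using f'[OF that] assms(2) that assms(3) by (rule has_derivative_transform_within_open)
  then show ?thesis using cont by (rule c1_onI)
qed

lemma c1_on_compose_affine:
  fixes f :: "'a::real_normed_vector \<Rightarrow> 'b::real_normed_vector"
    and A :: "'c::real_normed_vector \<Rightarrow>\<^sub>L 'a"
  assumes "c1_on U f" and V: "\<And>y. y \<in> V \<Longrightarrow> p + A y \<in> U"
  shows "c1_on V (\<lambda>y. f (p + A y))"
proof -
  obtain f' where f': "\<And>x. x \<in> U \<Longrightarrow> (f has_derivative blinfun_apply (f' x)) (at x)"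
    and cont: "continuous_on U f'" using assms(1) by (rule c1_onE) (rule that)
  have "((\<lambda>y. f (p + A y)) has_derivative blinfun_apply (f' (p + A y) o\<^sub>L A)) (at y)" if "y \<in> V" for y
  proof -
    have "((\<lambda>y. p + A y) has_derivative blinfun_apply A) (at y)"
      by (auto intro!: derivative_eq_intros bounded_linear_imp_has_derivative blinfun.bounded_linear_right)
    from has_derivative_compose[of "\<lambda>y. p + A y", OF this f'[OF V[OF that]]] show ?thesis
      by (rule has_derivative_eq_rhs) (simp add: fun_eq_iff)
  qed
  moreover have "continuous_on V (\<lambda>y. f' (p + A y) o\<^sub>L A)"
    by (intro continuous_intros continuous_on_compose2[OF cont]) (use V in auto)
  ultimately show ?thesis by (rule c1_onI)
qed

lemma c1_on_blinfun_compose: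
  fixes A :: "'b::real_normed_vector \<Rightarrow>\<^sub>L 'c::real_normed_vector"
  assumes "c1_on U f"
  shows "c1_on U (\<lambda>x. A (f x - p))"
proof -
  obtain f' where f': "\<And>x. x \<in> U \<Longrightarrow> (f has_derivative blinfun_apply (f' x)) (at x)"
    and cont: "continuous_on U f'" using assms by (rule c1_onE) (rule that)
  have "((\<lambda>x. A (f x - p)) has_derivative blinfun_apply (A o\<^sub>L f' x)) (at x)" if "x \<in> U" for x
    using bounded_linear.has_derivative[OF blinfun.bounded_linear_right[of A]
        has_derivative_diff[OF f'[OF that] has_derivative_const[of p]]]
    by (rule has_derivative_eq_rhs) (simp add: fun_eq_iff)
  moreover have "continuous_on U (\<lambda>x. A o\<^sub>L f' x)"
    by (intro continuous_intros cont)
  ultimately show ?thesis by (rule c1_onI)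
qed

text \<open>Replaces \<open>inv_into U f\<close>, which is awkward to differentiate, by any \<open>c\<^sup>1\<close> left inverse
  given by a formula.\<close>

lemma c1_diffeo_onI:
  assumes "open U" "open (f ` U)" "c1_on U f" "c1_on (f ` U) g" "\<And>x. x \<in> U \<Longrightarrow> g (f x) = x"
  shows "c1_diffeo_on U f"
proof -
  have inj: "inj_on f U" using assms(5) by (metis inj_onI)
  have "c1_on (f ` U) (inv_into U f)"
    using assms(4,2) by (rule c1_on_cong) (use assms(5) inj in auto)
  with assms inj show ?thesis unfolding c1_diffeo_on_def by blast
qed

lemma c1_diffeo_on_subset:
  assumes f: "c1_diffeo_on U f" and V: "open V" "V \<subseteq> U"
  shows "c1_diffeo_on V f"
proof -
  have inj: "inj_on f U" and op: "open (f ` U)" and f1: "c1_on U f" and g: "c1_on (f ` U) (inv_into U f)"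
    using f unfolding c1_diffeo_on_def by blast+
  have "f ` V = f ` U \<inter> inv_into U f -` V"
    using V inj by (auto simp: subset_iff)
  then have "open (f ` V)"
    using continuous_open_preimage[OF c1_on_imp_continuous_on[OF g] op V(1)] by simp
  then show ?thesis
    using V inj c1_on_subset[OF f1] c1_on_subset[OF g image_mono[OF V(2)]]
    by (intro c1_diffeo_onI[where g = "inv_into U f"]) auto
qed

lemma c1_diffeo_on_openin_subset:
  assumes f: "c1_diffeo_on U f" and V: "open V" "V \<subseteq> U"
    and S: "openin (top_of_set E) (f ` (S \<inter> U))"
  shows "openin (top_of_set E) (f ` (S \<inter> V))"
proof -
  have "inj_on f U" using f unfolding c1_diffeo_on_def by blast
  then have "f ` (S \<inter> V) = f ` (S \<inter> U) \<inter> f ` V"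
    using inj_on_image_Int[of f U "S \<inter> U" V] V(2) by (simp add: Int_absorb1 inf_assoc)
  moreover have "open (f ` V)"
    using c1_diffeo_on_subset[OF f V] unfolding c1_diffeo_on_def by blast
  ultimately show ?thesis using S by (simp add: openin_Int_open)
qed

text \<open>A chart may be renormalised by a translation and a linear homeomorphism of the target.\<close>

lemma c1_diffeo_on_affine:
  fixes A B :: "'a::real_normed_vector \<Rightarrow>\<^sub>L 'a"
  assumes f: "c1_diffeo_on U f" and AB: "\<And>v. A (B v) = v" "\<And>v. B (A v) = v"
  shows "c1_diffeo_on U (\<lambda>x. B (f x - p))"
proof (rule c1_diffeo_onI)
  let ?h = "\<lambda>x. B (f x - p)"
  have inj: "inj_on f U" and op: "open (f ` U)" and f1: "c1_on U f" and g: "c1_on (f ` U) (inv_into U f)"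
    using f unfolding c1_diffeo_on_def by blast+
  have "?h ` U = (\<lambda>y. p + A y) -` (f ` U)"
  proof (intro equalityI subsetI)
    fix y assume "y \<in> (\<lambda>y. p + A y) -` (f ` U)"
    then obtain x where x: "x \<in> U" "p + A y = f x" by auto
    then have "?h x = y" using AB(2) by (simp flip: x(2))
    then show "y \<in> ?h ` U" using x by blast
  qed (auto simp: AB)
  moreover have "open ((\<lambda>y. p + A y) -` (f ` U))"
    using op by (intro open_vimage continuous_on_add continuous_on_const linear_continuous_on
        blinfun.bounded_linear_right)
  ultimately show "open (?h ` U)" by simp
  show "c1_on (?h ` U) (\<lambda>y. inv_into U f (p + A y))"
    by (rule c1_on_compose_affine[OF g]) (auto simp: AB)
  show "inv_into U f (p + A (?h x)) = x" if "x \<in> U" for x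
    using that inj by (simp add: AB inv_into_f_f)
  show "open U" "c1_on U ?h"
    using f c1_on_blinfun_compose[OF f1] unfolding c1_diffeo_on_def by auto
qed

text \<open>By the chain rule the derivatives of a diffeomorphism and of its inverse are mutually inverse;
  in particular \<open>f'(x)\<^bsup>-1\<^esup> = G (f x)\<close> is continuous in \<open>x\<close>, without inverting operators.\<close>

lemma c1_diffeo_onE:
  fixes f :: "'a::real_normed_vector \<Rightarrow> 'a"
  assumes "c1_diffeo_on U f"
  obtains F G where
    "\<And>x. x \<in> U \<Longrightarrow> (f has_derivative blinfun_apply (F x)) (at x)" "continuous_on U F"
    "\<And>y. y \<in> f ` U \<Longrightarrow> (inv_into U f has_derivative blinfun_apply (G y)) (at y)"
    "continuous_on (f ` U) G"
    "\<And>x v. x \<in> U \<Longrightarrow> G (f x) (F x v) = v" "\<And>x v. x \<in> U \<Longrightarrow> F x (G (f x) v) = v"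
proof -
  let ?g = "inv_into U f"
  have inj: "inj_on f U" and op: "open U" "open (f ` U)" and f: "c1_on U f" and g: "c1_on (f ` U) ?g"
    using assms unfolding c1_diffeo_on_def by blast+
  obtain F where F: "\<And>x. x \<in> U \<Longrightarrow> (f has_derivative blinfun_apply (F x)) (at x)" "continuous_on U F"
    using f by (rule c1_onE) (rule that)
  obtain G where G: "\<And>y. y \<in> f ` U \<Longrightarrow> (?g has_derivative blinfun_apply (G y)) (at y)"
    "continuous_on (f ` U) G"
    using g by (rule c1_onE) (rule that)
  have "blinfun_apply (G (f x)) \<circ> blinfun_apply (F x) = id" if x: "x \<in> U" for x
  proof (rule has_derivative_unique)
    show "((?g \<circ> f) has_derivative blinfun_apply (G (f x)) \<circ> blinfun_apply (F x)) (at x)"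
      by (rule diff_chain_at[OF F(1) G(1)]) (use x in auto)
    show "((?g \<circ> f) has_derivative id) (at x)"
      by (rule has_derivative_transform_within_open[OF has_derivative_id op(1) x]) (simp add: inj)
  qed
  moreover have "blinfun_apply (F x) \<circ> blinfun_apply (G (f x)) = id" if x: "x \<in> U" for x
  proof (rule has_derivative_unique)
    have "(f has_derivative blinfun_apply (F x)) (at (?g (f x)))" using F(1) x inj by simp
    then show "((f \<circ> ?g) has_derivative blinfun_apply (F x) \<circ> blinfun_apply (G (f x))) (at (f x))"
      by (intro diff_chain_at G(1)) (use x in auto)
    show "((f \<circ> ?g) has_derivative id) (at (f x))"
      by (rule has_derivative_transform_within_open[OF has_derivative_id op(2)])
        (use x in \<open>auto simp: inj f_inv_into_f\<close>)
  qed
  ultimately have "G (f x) (F x v) = v" "F x (G (f x) v) = v" if "x \<in> U" for x v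
    using that by (simp_all add: fun_eq_iff)
  with F G show ?thesis by (rule that)
qed

section \<open>Tangent spaces in a chart\<close>

text \<open>The derivative is a limit of difference quotients, which lie in the subspace.\<close>

lemma vector_derivative_in_closed_subspace:
  assumes "(\<gamma> has_vector_derivative w) (at a)" and E: "subspace E" "closed E"
    and ev: "\<forall>\<^sub>F t in nhds a. \<gamma> t \<in> E"
  shows "w \<in> E"
proof -
  have "(\<lambda>h. norm (\<gamma> (a + h) - \<gamma> a - h *\<^sub>R w) / norm h) \<midarrow>0\<rightarrow> 0"
    using assms(1) unfolding has_vector_derivative_def has_derivative_at by simp
  moreover have "\<forall>\<^sub>F h in at 0. norm (\<gamma> (a + h) - \<gamma> a - h *\<^sub>R w) / norm h
      = norm ((\<gamma> (a + h) - \<gamma> a) /\<^sub>R h - w)"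
  proof (rule eventually_at_topological[THEN iffD2], intro exI[of _ UNIV] conjI ballI impI)
    fix h :: real assume "h \<noteq> 0"
    then have "(\<gamma> (a + h) - \<gamma> a) /\<^sub>R h - w = (\<gamma> (a + h) - \<gamma> a - h *\<^sub>R w) /\<^sub>R h"
      by (simp add: scaleR_diff_right)
    then show "norm (\<gamma> (a + h) - \<gamma> a - h *\<^sub>R w) / norm h = norm ((\<gamma> (a + h) - \<gamma> a) /\<^sub>R h - w)"
      by (simp add: divide_inverse mult.commute)
  qed auto
  ultimately have "(\<lambda>h. norm ((\<gamma> (a + h) - \<gamma> a) /\<^sub>R h - w)) \<midarrow>0\<rightarrow> 0"
    by (rule Lim_transform_eventually)
  then have lim: "(\<lambda>h. (\<gamma> (a + h) - \<gamma> a) /\<^sub>R h) \<midarrow>0\<rightarrow> w"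
    by (rule LIM_zero_cancel[OF tendsto_norm_zero_cancel])
  have "filterlim (\<lambda>h. a + h) (nhds a) (at 0)"
    by (auto intro!: tendsto_eq_intros)
  then have "\<forall>\<^sub>F h in at 0. \<gamma> (a + h) \<in> E" by (rule eventually_compose_filterlim[OF ev])
  then have "\<forall>\<^sub>F h in at 0. (\<gamma> (a + h) - \<gamma> a) /\<^sub>R h \<in> E"
    by eventually_elim (intro subspace_scale[OF E(1)] subspace_diff[OF E(1)] eventually_nhds_x_imp_x[OF ev])
  then show ?thesis by (rule Lim_in_closed_set[OF E(2) _ _ lim]) simp
qed

text \<open>A curve in \<open>S\<close> is mapped by \<open>f\<close> into the closed subspace \<open>E\<close>, so its velocity \<open>v\<close> satisfies
  \<open>F v \<in> E\<close>. Conversely, for such a \<open>v\<close> the segment \<open>f x + t *\<^sub>R F v\<close> stays in \<open>E\<close>, for small \<open>t\<close> in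
  the open part \<open>f ` (S \<inter> U)\<close>, and its preimage under \<open>f\<close> is a curve in \<open>S\<close> with velocity \<open>v\<close>.\<close>

lemma tangent_space_in_chart:
  fixes f :: "'a::real_normed_vector \<Rightarrow> 'a"
  assumes f: "c1_diffeo_on U f" and E: "subspace E" "closed E"
    and S: "openin (top_of_set E) (f ` (S \<inter> U))" and x: "x \<in> S" "x \<in> U"
    and F: "(f has_derivative F) (at x)"
  shows "tangent_space S x = {v. F v \<in> E}"
proof (intro equalityI subsetI CollectI)
  have fE: "f ` (S \<inter> U) \<subseteq> E" using S by (rule openin_imp_subset)
  fix v assume "v \<in> tangent_space S x"
  then obtain \<delta> c where \<delta>: "\<delta> > 0" and c: "c ` {-\<delta><..<\<delta>} \<subseteq> S" "c 0 = x"
    and v: "(c has_vector_derivative v) (at 0)"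
    unfolding tangent_space_def mem_Collect_eq by (elim exE conjE) (rule that)
  have "((\<lambda>t. f (c t)) has_derivative (\<lambda>t. F (t *\<^sub>R v))) (at 0)"
    using has_derivative_compose[OF v[unfolded has_vector_derivative_def], of f F] F c by simp
  then have "((\<lambda>t. f (c t)) has_vector_derivative F v) (at 0)"
    unfolding has_vector_derivative_def using linear_scale[OF has_derivative_linear[OF F]] by simp
  moreover have "\<forall>\<^sub>F t in nhds 0. f (c t) \<in> E"
  proof -
    have "(c \<longlongrightarrow> x) (nhds 0)"
      using has_vector_derivative_continuous[OF v] c(2) by (simp add: isCont_def tendsto_nhds_iff)
    moreover have "open U" using f unfolding c1_diffeo_on_def by blast
    ultimately have "\<forall>\<^sub>F t in nhds 0. c t \<in> U" using x topological_tendstoD by blast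
    moreover have "\<forall>\<^sub>F t in nhds 0. t \<in> {-\<delta><..<\<delta>}"
      by (rule eventually_nhds_in_open) (use \<delta> in auto)
    ultimately show ?thesis by eventually_elim (use c fE in blast)
  qed
  ultimately show "F v \<in> E" using E by (intro vector_derivative_in_closed_subspace)
next
  fix v assume "v \<in> {v. F v \<in> E}"
  then have v: "F v \<in> E" by simp
  let ?g = "inv_into U f"
  have inj: "inj_on f U" using f unfolding c1_diffeo_on_def by blast
  obtain F' G where F': "\<And>x. x \<in> U \<Longrightarrow> (f has_derivative blinfun_apply (F' x)) (at x)" "continuous_on U F'"
    and G: "\<And>y. y \<in> f ` U \<Longrightarrow> (?g has_derivative blinfun_apply (G y)) (at y)" "continuous_on (f ` U) G"
    and GF: "\<And>x v. x \<in> U \<Longrightarrow> G (f x) (F' x v) = v" "\<And>x v. x \<in> U \<Longrightarrow> F' x (G (f x) v) = v"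
    using f by (rule c1_diffeo_onE) (rule that)
  have FF: "F = blinfun_apply (F' x)" using F F'(1)[OF x(2)] by (rule has_derivative_unique)
  define l where "l t = f x + t *\<^sub>R F v" for t
  obtain W where W: "open W" "f ` (S \<inter> U) = E \<inter> W" using S unfolding openin_open by blast
  have lim: "(l \<longlongrightarrow> f x) (nhds 0)"
    unfolding l_def by (auto intro!: tendsto_eq_intros filterlim_ident)
  have "f x \<in> E \<inter> W" using x W by blast
  then have "\<forall>\<^sub>F t in nhds 0. l t \<in> W" using lim W(1) topological_tendstoD by blast
  then obtain \<delta> where \<delta>: "\<delta> > 0" "\<And>t. \<bar>t\<bar> < \<delta> \<Longrightarrow> l t \<in> W"
    unfolding eventually_nhds_metric by (auto simp: dist_real_def)
  have l: "l t \<in> f ` (S \<inter> U)" if "t \<in> {-\<delta><..<\<delta>}" for t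
    using \<delta>(2)[of t] that W(2) v \<open>f x \<in> E \<inter> W\<close> E
    by (auto simp: l_def abs_less_iff intro: subspace_add subspace_scale)
  have vd: "((\<lambda>t. ?g (l t)) has_vector_derivative G (l t) (F v)) (at t)" if "t \<in> {-\<delta><..<\<delta>}" for t
  proof -
    have "(l has_derivative (\<lambda>s. s *\<^sub>R F v)) (at t)"
      unfolding l_def by (auto intro!: derivative_eq_intros)
    from has_derivative_compose[OF this G(1)] l[OF that] show ?thesis
      unfolding has_vector_derivative_def by (auto simp: blinfun.scaleR_right)
  qed
  have "continuous_on {-\<delta><..<\<delta>} l" unfolding l_def by (intro continuous_intros)
  moreover have "l ` {-\<delta><..<\<delta>} \<subseteq> f ` U" using l by blast
  ultimately have "continuous_on {-\<delta><..<\<delta>} (\<lambda>t. G (l t) (F v))"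
    by (intro continuous_intros continuous_on_compose2[OF G(2)])
  then have "(\<lambda>t. ?g (l t)) C1_differentiable_on {-\<delta><..<\<delta>}"
    unfolding C1_differentiable_on_def using vd by (intro exI[of _ "\<lambda>t. G (l t) (F v)"] conjI ballI)
  moreover have "(\<lambda>t. ?g (l t)) ` {-\<delta><..<\<delta>} \<subseteq> S"
  proof (rule image_subsetI)
    fix t assume "t \<in> {-\<delta><..<\<delta>}"
    then obtain s where "s \<in> S" "s \<in> U" "l t = f s" using l by blast
    then show "?g (l t) \<in> S" using inj by simp
  qed
  moreover have "?g (l 0) = x" using inj x by (simp add: l_def)
  moreover have "((\<lambda>t. ?g (l t)) has_vector_derivative v) (at 0)"
    using vd[of 0] \<delta>(1) GF(1)[OF x(2)] by (simp add: l_def FF)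
  ultimately show "v \<in> tangent_space S x"
    unfolding tangent_space_def mem_Collect_eq using \<delta>(1)
    by (intro exI[of _ \<delta>] exI[of _ "\<lambda>t. ?g (l t)"] conjI)
qed

section \<open>Integral submanifolds and co-tailed sets\<close>

theorem theorem2p1:
  fixes \<Lambda> :: "'a::banach set" and M :: "'a \<Rightarrow> 'a set" and x\<^sub>0 :: 'a and S :: "'a set"
  assumes "open \<Lambda>" and "x\<^sub>0 \<in> \<Lambda>"
    and "\<And>x. x \<in> \<Lambda> \<Longrightarrow> subspace (M x)"
    and "c1_integrable_at \<Lambda> M x\<^sub>0"
    and "integral_submanifold \<Lambda> M x\<^sub>0 S"
  shows "splitting (M x\<^sub>0) \<and>
    (\<forall>N. direct_sum_decomp (M x\<^sub>0) N \<longrightarrow>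
      (\<exists>U\<^sub>0 \<phi>. x\<^sub>0 \<in> U\<^sub>0 \<and> c1_diffeo_on U\<^sub>0 (\<phi> :: 'a \<Rightarrow> 'a) \<and>
        frechet_derivative \<phi> (at x\<^sub>0) = id \<and>
        openin (top_of_set (M x\<^sub>0)) (\<phi> ` (S \<inter> U\<^sub>0)) \<and>
        (\<forall>x \<in> S \<inter> U\<^sub>0. frechet_derivative \<phi> (at x) ` M x = M x\<^sub>0) \<and>
        U\<^sub>0 \<inter> S \<subseteq> co_tailed_set \<Lambda> M N))"
proof -
  have S: "c1_submanifold S" "x\<^sub>0 \<in> S" "S \<subseteq> \<Lambda>" "\<And>x. x \<in> S \<Longrightarrow> tangent_space S x = M x"
    using assms(5) unfolding integral_submanifold_def by simp_all
  from S(1,2) have "\<exists>E U f. splitting E \<and> x\<^sub>0 \<in> U \<and> c1_diffeo_on U (f :: 'a \<Rightarrow> 'a) \<and>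
      openin (top_of_set E) (f ` (S \<inter> U))"
    unfolding c1_submanifold_def by (rule bspec)
  then obtain E U and f :: "'a \<Rightarrow> 'a" where split: "splitting E" and x0: "x\<^sub>0 \<in> U"
    and f: "c1_diffeo_on U f" and fS: "openin (top_of_set E) (f ` (S \<inter> U))"
    by (elim exE conjE) (rule that)
  obtain E' where EE': "direct_sum_decomp E E'" using split unfolding splitting_def by (elim exE)
  then have E: "subspace E" "closed E" and E': "closed E'" unfolding direct_sum_decomp_def by simp_all
  have op: "open U" using f unfolding c1_diffeo_on_def by simp
  have fE: "f ` (S \<inter> U) \<subseteq> E" using fS by (rule openin_imp_subset)
  obtain F G where F: "\<And>x. x \<in> U \<Longrightarrow> (f has_derivative blinfun_apply (F x)) (at x)" "continuous_on U F"
    and G: "\<And>y. y \<in> f ` U \<Longrightarrow> (inv_into U f has_derivative blinfun_apply (G y)) (at y)"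
      "continuous_on (f ` U) G"
    and GF: "\<And>x v. x \<in> U \<Longrightarrow> G (f x) (F x v) = v" and FG: "\<And>x v. x \<in> U \<Longrightarrow> F x (G (f x) v) = v"
    using f by (rule c1_diffeo_onE) (rule that)
  have M_vimage: "M x = {v. F x v \<in> E}" if "x \<in> S" "x \<in> U" for x
    using tangent_space_in_chart[OF f E fS that F(1)[OF that(2)]] S(4)[OF that(1)] by simp
  have G_image: "G (f x) ` X = {v. F x v \<in> X}" if "x \<in> U" for x X
    using that by (auto simp: FG) (metis GF imageI)
  \<comment> \<open>All closedness claims about images under \<open>f'(x)\<^bsup>-1\<^esup>\<close> are read off from preimages under \<open>f'(x)\<close>.\<close>
  have closed_vimage: "closed {v. F x v \<in> X}" if "closed X" for x X
    using closed_vimage[OF that, of "F x"]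
    by (simp add: vimage_def linear_continuous_on blinfun.bounded_linear_right)
  let ?A = "F x\<^sub>0" and ?B = "G (f x\<^sub>0)"
  have M0: "M x\<^sub>0 = {v. ?A v \<in> E}" using M_vimage S(2) x0 by simp
  have "direct_sum_decomp (?B ` E) (?B ` E')"
  proof (rule direct_sum_decomp_image[OF _ _ EE'])
    show "linear ?B" by (simp add: blinfun.bounded_linear_right bounded_linear.linear)
    show "bij ?B" by (rule o_bij[of ?A]) (simp_all add: fun_eq_iff FG GF x0)
    show "closed (?B ` E)" "closed (?B ` E')"
      using closed_vimage E(2) E' by (simp_all add: G_image x0)
  qed
  then have split0: "splitting (M x\<^sub>0)"
    unfolding splitting_def M0 G_image[OF x0] by (rule exI)
  \<comment> \<open>The chart \<open>f\<close>, normalised to have value \<open>0\<close> and derivative \<open>I\<close> at \<open>x\<^sub>0\<close>.\<close>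
  define \<phi> where "\<phi> x = ?B (f x - f x\<^sub>0)" for x
  have \<phi>: "c1_diffeo_on U \<phi>"
    unfolding \<phi>_def by (rule c1_diffeo_on_affine[OF f FG[OF x0] GF[OF x0]])
  have \<phi>': "frechet_derivative \<phi> (at x) = (\<lambda>v. ?B (F x v))" if "x \<in> U" for x
    unfolding \<phi>_def
    using bounded_linear.has_derivative[OF blinfun.bounded_linear_right[of ?B]
        has_derivative_diff[OF F(1)[OF that] has_derivative_const[of "f x\<^sub>0"]]]
    by (intro frechet_derivative_at[symmetric]) simp
  have \<phi>S: "openin (top_of_set (M x\<^sub>0)) (\<phi> ` (S \<inter> U))"
  proof -
    obtain W where W: "open W" "f ` (S \<inter> U) = E \<inter> W" using fS unfolding openin_open by blast
    \<comment> \<open>The translation by \<open>f x\<^sub>0\<close> preserves \<open>E\<close>, because \<open>x\<^sub>0 \<in> S\<close>.\<close>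
    have f0: "f x\<^sub>0 \<in> E" using fE S(2) x0 by blast
    have shift: "f x\<^sub>0 + e \<in> E \<longleftrightarrow> e \<in> E" for e
      using subspace_add[OF E(1) f0] subspace_diff[OF E(1) _ f0, of "f x\<^sub>0 + e"] by auto
    have "\<phi> ` (S \<inter> U) = (\<lambda>y. ?B (y - f x\<^sub>0)) ` (E \<inter> W)"
      unfolding W(2)[symmetric] by (simp add: \<phi>_def image_image)
    also have "\<dots> = M x\<^sub>0 \<inter> (\<lambda>v. f x\<^sub>0 + ?A v) -` W"
    proof (intro equalityI subsetI)
      fix v assume "v \<in> M x\<^sub>0 \<inter> (\<lambda>v. f x\<^sub>0 + ?A v) -` W"
      then have "f x\<^sub>0 + ?A v \<in> E \<inter> W" by (simp add: M0 shift)
      moreover have "v = ?B (f x\<^sub>0 + ?A v - f x\<^sub>0)" by (simp add: GF x0)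
      ultimately show "v \<in> (\<lambda>y. ?B (y - f x\<^sub>0)) ` (E \<inter> W)" by (rule rev_image_eqI)
    qed (use f0 in \<open>auto simp: M0 FG x0 intro: subspace_diff[OF E(1)]\<close>)
    finally have "\<phi> ` (S \<inter> U) = M x\<^sub>0 \<inter> (\<lambda>v. f x\<^sub>0 + ?A v) -` W" .
    moreover have "open ((\<lambda>v. f x\<^sub>0 + ?A v) -` W)"
      using W(1) by (intro open_vimage continuous_on_add continuous_on_const linear_continuous_on
          blinfun.bounded_linear_right)
    ultimately show ?thesis by (simp add: openin_open_Int)
  qed
  have "\<exists>U\<^sub>0 \<phi>. x\<^sub>0 \<in> U\<^sub>0 \<and> c1_diffeo_on U\<^sub>0 (\<phi> :: 'a \<Rightarrow> 'a) \<and>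
        frechet_derivative \<phi> (at x\<^sub>0) = id \<and>
        openin (top_of_set (M x\<^sub>0)) (\<phi> ` (S \<inter> U\<^sub>0)) \<and>
        (\<forall>x \<in> S \<inter> U\<^sub>0. frechet_derivative \<phi> (at x) ` M x = M x\<^sub>0) \<and>
        U\<^sub>0 \<inter> S \<subseteq> co_tailed_set \<Lambda> M N" if N: "direct_sum_decomp (M x\<^sub>0) N" for N
  proof -
    obtain Q where Q: "bounded_linear Q" "\<And>m. m \<in> M x\<^sub>0 \<Longrightarrow> Q m = m" "\<And>n. n \<in> N \<Longrightarrow> Q n = 0"
      using N by (rule direct_sum_decomp_projection) (rule that)
    define P where "P = Blinfun Q"
    have P: "P m = m" if "m \<in> M x\<^sub>0" for m
      using Q(2)[OF that] by (simp add: P_def bounded_linear_Blinfun_apply[OF Q(1)])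
    have PN: "P n = 0" if "n \<in> N" for n
      using Q(3)[OF that] by (simp add: P_def bounded_linear_Blinfun_apply[OF Q(1)])
    \<comment> \<open>\<open>T x\<close> moves \<open>M x\<^sub>0\<close> onto \<open>M x\<close> through \<open>E\<close> and is the identity on \<open>N\<close>.\<close>
    define T where "T x = (G (f x) o\<^sub>L ?A o\<^sub>L P) + (id_blinfun - P)" for x
    have T_cont: "continuous_on U T"
    proof -
      have "continuous_on U f" using f unfolding c1_diffeo_on_def by (simp add: c1_on_imp_continuous_on)
      then show ?thesis unfolding T_def
        by (intro continuous_intros continuous_on_compose2[OF G(2)]) auto
    qed
    have "T x\<^sub>0 = id_blinfun"
      by (rule blinfun_eqI) (simp add: T_def blinfun.add_left blinfun.diff_left GF x0)
    define U\<^sub>0 where "U\<^sub>0 = U \<inter> T -` ball id_blinfun 1"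
    have U0: "open U\<^sub>0" "U\<^sub>0 \<subseteq> U"
      unfolding U\<^sub>0_def using continuous_open_preimage[OF T_cont op open_ball] by auto
    have x00: "x\<^sub>0 \<in> U\<^sub>0" by (simp add: U\<^sub>0_def x0 \<open>T x\<^sub>0 = id_blinfun\<close>)
    have "direct_sum_decomp (M x) N" if x: "x \<in> S" "x \<in> U\<^sub>0" for x
    proof -
      have xU: "x \<in> U" using x U0 by blast
      have "T x ` M x\<^sub>0 = G (f x) ` ?A ` M x\<^sub>0"
        by (simp add: image_image T_def blinfun.add_left blinfun.diff_left P cong: image_cong_simp)
      also have "?A ` M x\<^sub>0 = E"
        by (auto simp: M0 image_iff) (metis FG x0)
      also have "G (f x) ` E = M x" using G_image M_vimage xU x(1) by simp
      finally have TM: "T x ` M x\<^sub>0 = M x" .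
      have TN: "T x ` N = N"
        by (simp add: T_def blinfun.add_left blinfun.diff_left PN blinfun.zero_right cong: image_cong_simp)
      have "direct_sum_decomp (T x ` M x\<^sub>0) (T x ` N)"
      proof (rule direct_sum_decomp_image[OF _ _ N])
        show "linear (T x)" by (simp add: blinfun.bounded_linear_right bounded_linear.linear)
        show "bij (T x)"
          using x(2) by (intro bij_blinfun_near_id) (simp add: U\<^sub>0_def dist_norm norm_minus_commute)
        show "closed (T x ` M x\<^sub>0)"
          unfolding TM M_vimage[OF x(1) xU] using E(2) by (rule closed_vimage)
        show "closed (T x ` N)" unfolding TN using N unfolding direct_sum_decomp_def by simp
      qed
      then show ?thesis by (simp only: TM TN)
    qed
    then have "U\<^sub>0 \<inter> S \<subseteq> co_tailed_set \<Lambda> M N"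
      using S(3) by (auto simp: co_tailed_set_def)
    moreover have "frechet_derivative \<phi> (at x) ` M x = M x\<^sub>0" if "x \<in> S \<inter> U\<^sub>0" for x
    proof -
      have x: "x \<in> S" "x \<in> U" using that U0 by auto
      have "F x ` M x = E"
        by (auto simp: M_vimage[OF x] image_iff) (metis FG x(2))
      then have "(\<lambda>v. ?B (F x v)) ` M x = ?B ` E" by (metis image_image)
      then show ?thesis by (simp add: \<phi>' x(2) M0 G_image x0)
    qed
    moreover have "frechet_derivative \<phi> (at x\<^sub>0) = id" by (simp add: \<phi>' x0 GF fun_eq_iff)
    ultimately show ?thesis
      using x00 c1_diffeo_on_subset[OF \<phi> U0] c1_diffeo_on_openin_subset[OF \<phi> U0 \<phi>S]
      by (intro exI[of _ U\<^sub>0] exI[of _ \<phi>] conjI ballI)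
  qed
  with split0 show ?thesis by (intro conjI allI impI)
qed

end
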